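(* Let $S\subset\mathbb{R}^m$ be a $1$-dimensional semialgebraic set which is a polynomial image of $\mathbb{R}^n$ for some $n\geq 1$. Then $\mathrm{p}(S)=1$ if and only if $S$ is closed in $\mathbb{R}^m$.
   Context: A map $f=(f_1,\dots,f_m):\mathbb{R}^n\to\mathbb{R}^m$ is polynomial if each $f_i\in\mathbb{R}[x_1,\dots,x_n]$. A set $S\subset\mathbb{R}^m$ is a polynomial image of $\mathbb{R}^n$ if $S=f(\mathbb{R}^n)$ for some polynomial map $f:\mathbb{R}^n\to\mathbb{R}^m$. The invariant $\mathrm{p}(S)$ is the least $p\geq1$ such that $S$ is a polynomial image of $\mathbb{R}^p$, and $+\infty$ if there is no such $p$. *)

theory Defs
  imports
    "HOL-Analysis.Analysis"
    "HOL-Algebra.QuotRing"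
    "HOL-Algebra.Algebraic_Closure_Type"
    "HOL-Library.Poly_Mapping"
    "HOL-Library.Extended_Nat"
begin

text \<open>
  A real polynomial with variables indexed by \<open>'v\<close> is a finitely supported map from
  monomials to coefficients, a monomial being a finitely supported map from variables to exponents.
\<close>

type_synonym 'v rpoly = "('v \<Rightarrow>\<^sub>0 nat) \<Rightarrow>\<^sub>0 real"

definition rpoly_eval :: "'v rpoly \<Rightarrow> ('v \<Rightarrow> real) \<Rightarrow> real" where
  "rpoly_eval P x =
     (\<Sum>u\<in>Poly_Mapping.keys P.
        Poly_Mapping.lookup P u * (\<Prod>i\<in>Poly_Mapping.keys u. x i ^ Poly_Mapping.lookup u i))"

text \<open>
  Since the dimension of the source space has to be quantified over, \<open>\<real>\<^sup>n\<close> is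
  \<^term>\<open>topspace (Euclidean_space n)\<close>, that is, the set of all \<open>x :: nat \<Rightarrow> real\<close> with
  \<open>x i = 0\<close> for \<open>i \<ge> n\<close>; the variables are \<open>x 0, \<dots>, x (n - 1)\<close>. The target
  \<open>\<real>\<^sup>m\<close> is \<open>real ^ 'm\<close>.
\<close>

definition rpolys :: "nat \<Rightarrow> nat rpoly set" where
  "rpolys n = {P. \<forall>u\<in>Poly_Mapping.keys P. Poly_Mapping.keys u \<subseteq> {..<n}}"

definition polynomial_map :: "nat \<Rightarrow> ((nat \<Rightarrow> real) \<Rightarrow> real ^ 'm) \<Rightarrow> bool" where
  "polynomial_map n f \<longleftrightarrow>
     (\<forall>j. \<exists>P\<in>rpolys n. \<forall>x\<in>topspace (Euclidean_space n). f x $ j = rpoly_eval P x)"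

definition polynomial_image :: "nat \<Rightarrow> (real ^ 'm) set \<Rightarrow> bool" where
  "polynomial_image n S \<longleftrightarrow>
     (\<exists>f. polynomial_map n f \<and> S = f ` topspace (Euclidean_space n))"

text \<open>In \<^typ>\<open>enat\<close> the infimum of the empty set is \<open>\<infinity>\<close>.\<close>

definition p_invariant :: "(real ^ 'm) set \<Rightarrow> enat" where
  "p_invariant S = Inf {enat p | p. p \<ge> 1 \<and> polynomial_image p S}"

text \<open>Finite boolean combinations of polynomial equalities and inequalities.\<close>

inductive semialgebraic :: "(real ^ 'm) set \<Rightarrow> bool" where
  eq: "semialgebraic {x. rpoly_eval P (($) x) = 0}"
| pos: "semialgebraic {x. rpoly_eval P (($) x) > 0}"
| un: "semialgebraic A \<Longrightarrow> semialgebraic B \<Longrightarrow> semialgebraic (A \<union> B)"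
| int: "semialgebraic A \<Longrightarrow> semialgebraic B \<Longrightarrow> semialgebraic (A \<inter> B)"
| compl: "semialgebraic A \<Longrightarrow> semialgebraic (- A)"

text \<open>
  The dimension of a semialgebraic set \<open>S \<subseteq> \<real>\<^sup>m\<close> is, following Bochnak, Coste and Roy,
  the Krull dimension of the ring \<open>\<real>[x\<^sub>1,\<dots>,x\<^sub>m] / I(S)\<close> of polynomial functions on \<open>S\<close>.
  The zero ring, which arises for \<open>S = {}\<close>, gets Krull dimension \<open>0\<close> here.
\<close>

definition vanishing_ideal :: "(real ^ 'm) set \<Rightarrow> 'm rpoly set" where
  "vanishing_ideal S = {P. \<forall>x\<in>S. rpoly_eval P (($) x) = 0}"

definition krull_dim :: "('a, 'b) ring_scheme \<Rightarrow> enat" where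
  "krull_dim R =
     Sup {enat d | d. \<exists>Q. (\<forall>i\<le>d. primeideal (Q i) R) \<and> (\<forall>i<d. Q i \<subset> Q (Suc i))}"

definition semialgebraic_dim :: "(real ^ 'm) set \<Rightarrow> enat" where
  "semialgebraic_dim S =
     krull_dim ((ring_of_type_algebra :: 'm rpoly ring) Quot vanishing_ideal S)"

end

theory Submission
  imports
    Defs
    "HOL-Computational_Algebra.Computational_Algebra"
begin

text \<open>
  Restricting a polynomial map \<open>f\<close> with image \<open>S\<close> to a line gives a polynomial curve in \<open>S\<close>. Its vanishing
  ideal is prime and, unless the curve is constant, lies strictly below that of a point; as the prime ideal
  \<open>I(S)\<close> has coheight \<open>1\<close>, all nonconstant curves of this kind have the same vanishing ideal \<open>I(S)\<close>.
  By the polynomial version of Lueroth's theorem one such curve is \<open>\<gamma> \<circ> h\<close> with \<open>h\<close> a rational function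
  \<open>a/b\<close> of the point on the curve; as the ideals agree, every other one is \<open>\<gamma> \<circ> h'\<close>, and \<open>h'\<close> is again
  \<open>a/b\<close> of the point. Taking the lines through a point with \<open>b \<noteq> 0\<close>, all the intervals \<open>h'(\<real>)\<close> share a
  common parameter, so \<open>S = \<gamma>(T)\<close> for an unbounded interval \<open>T\<close>. If \<open>S\<close> is closed, a missing finite
  endpoint of \<open>T\<close> may be added, and a closed half-line is the image of \<open>s \<mapsto> c \<plusminus> s\<^sup>2\<close>. Conversely, a
  nonconstant polynomial curve is a proper map.
\<close>

hide_const (open) Module.smult Polynomials.degree Polynomials.lead_coeff up_ring.coeff up_ring.monom

subsection \<open>Evaluation and substitution\<close>

definition monom_eval :: "('v \<Rightarrow>\<^sub>0 nat) \<Rightarrow> ('v \<Rightarrow> real) \<Rightarrow> real" where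
  "monom_eval u x = (\<Prod>i\<in>Poly_Mapping.keys u. x i ^ Poly_Mapping.lookup u i)"

lemma monom_eval_superset:
  assumes "finite K" "Poly_Mapping.keys u \<subseteq> K"
  shows "monom_eval u x = (\<Prod>i\<in>K. x i ^ Poly_Mapping.lookup u i)"
  unfolding monom_eval_def using assms
  by (intro prod.mono_neutral_left) (auto simp: in_keys_iff)

lemma monom_eval_add: "monom_eval (u + v) x = monom_eval u x * monom_eval v x"
proof -
  let ?K = "Poly_Mapping.keys u \<union> Poly_Mapping.keys v"
  have "monom_eval (u + v) x = (\<Prod>i\<in>?K. x i ^ Poly_Mapping.lookup (u + v) i)"
    by (rule monom_eval_superset) (use keys_add[of u v] in auto)
  also have "\<dots> = monom_eval u x * monom_eval v x"
    by (simp add: monom_eval_superset[of ?K] lookup_add power_add prod.distrib)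
  finally show ?thesis .
qed

lemma rpoly_eval_monom_eval:
  "rpoly_eval P x = (\<Sum>u\<in>Poly_Mapping.keys P. Poly_Mapping.lookup P u * monom_eval u x)"
  by (simp add: rpoly_eval_def monom_eval_def)

lemma rpoly_eval_single: "rpoly_eval (Poly_Mapping.single u c) x = c * monom_eval u x"
  by (cases "c = 0") (auto simp: rpoly_eval_monom_eval)

lemma rpoly_eval_add: "rpoly_eval (P + Q) x = rpoly_eval P x + rpoly_eval Q x"
  unfolding rpoly_eval_monom_eval
  by (rule setsum_keys_plus_distrib) (auto simp: algebra_simps)

lemma rpoly_eval_0 [simp]: "rpoly_eval 0 x = 0"
  by (simp add: rpoly_eval_def)

lemma rpoly_eval_sum: "rpoly_eval (sum F A) x = (\<Sum>a\<in>A. rpoly_eval (F a) x)"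
  by (induction A rule: infinite_finite_induct) (auto simp: rpoly_eval_add)

lemma rpoly_sum_monomials:
  "(P :: 'v rpoly) = (\<Sum>u\<in>Poly_Mapping.keys P. Poly_Mapping.single u (Poly_Mapping.lookup P u))"
proof (rule poly_mapping_eqI)
  fix v
  show "Poly_Mapping.lookup P v = Poly_Mapping.lookup
      (\<Sum>u\<in>Poly_Mapping.keys P. Poly_Mapping.single u (Poly_Mapping.lookup P u)) v"
    by (auto simp: lookup_sum lookup_single when_def sum.delta in_keys_iff)
qed

lemma rpoly_eval_mult: "rpoly_eval (P * Q) x = rpoly_eval P x * rpoly_eval Q x"
proof -
  have "P * Q = (\<Sum>u\<in>Poly_Mapping.keys P. \<Sum>v\<in>Poly_Mapping.keys Q.
      Poly_Mapping.single (u + v) (Poly_Mapping.lookup P u * Poly_Mapping.lookup Q v))"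
    by (subst rpoly_sum_monomials[of P], subst rpoly_sum_monomials[of Q])
      (simp add: sum_product mult_single)
  then show ?thesis
    by (simp add: rpoly_eval_sum rpoly_eval_single monom_eval_add)
      (simp add: rpoly_eval_monom_eval sum_product mult_ac)
qed

definition rpoly_const :: "real \<Rightarrow> 'v rpoly" where
  "rpoly_const c = Poly_Mapping.single 0 c"

definition rpoly_var :: "'v \<Rightarrow> 'v rpoly" where
  "rpoly_var i = Poly_Mapping.single (Poly_Mapping.single i 1) 1"

lemma rpoly_eval_const [simp]: "rpoly_eval (rpoly_const c) x = c"
  by (simp add: rpoly_const_def rpoly_eval_single monom_eval_def)

lemma rpoly_eval_var [simp]: "rpoly_eval (rpoly_var i) x = x i"
  by (simp add: rpoly_var_def rpoly_eval_single monom_eval_def)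

lemma rpoly_const_1: "rpoly_const 1 = 1"
  by (simp add: rpoly_const_def)

lemma rpoly_eval_1 [simp]: "rpoly_eval 1 x = 1"
  by (metis rpoly_const_1 rpoly_eval_const)

lemma rpoly_eval_uminus: "rpoly_eval (- P) x = - rpoly_eval P x"
  using rpoly_eval_add[of P "- P" x] by simp

lemma rpoly_eval_diff: "rpoly_eval (P - Q) x = rpoly_eval P x - rpoly_eval Q x"
  using rpoly_eval_add[of P "- Q" x] by (simp add: rpoly_eval_uminus)

lemma rpoly_eval_power: "rpoly_eval (P ^ k) x = rpoly_eval P x ^ k"
  by (induction k) (auto simp: rpoly_eval_mult)

lemmas rpoly_eval_simps =
  rpoly_eval_add rpoly_eval_mult rpoly_eval_uminus rpoly_eval_diff rpoly_eval_power rpoly_eval_sum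

definition rpoly_subst :: "'v rpoly \<Rightarrow> ('v \<Rightarrow> real poly) \<Rightarrow> real poly" where
  "rpoly_subst P g = (\<Sum>u\<in>Poly_Mapping.keys P.
     smult (Poly_Mapping.lookup P u) (\<Prod>i\<in>Poly_Mapping.keys u. g i ^ Poly_Mapping.lookup u i))"

lemma poly_rpoly_subst: "poly (rpoly_subst P g) s = rpoly_eval P (\<lambda>i. poly (g i) s)"
  by (simp add: rpoly_subst_def rpoly_eval_def poly_sum poly_prod)

text \<open>A real polynomial is determined by its values, so the algebraic laws of substitution
  reduce to those of evaluation.\<close>

lemma rpoly_subst_eqI:
  assumes "\<And>s. rpoly_eval P (\<lambda>i. poly (g i) s) = poly p s"
  shows "rpoly_subst P g = p"
  using assms by (intro poly_eqI_degree_lead_coeff poly_eq_poly_eq_iff[THEN iffD1] ext)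
    (simp add: poly_rpoly_subst)

lemma rpoly_subst_simps [simp]:
  "rpoly_subst (P + Q) g = rpoly_subst P g + rpoly_subst Q g"
  "rpoly_subst (P * Q) g = rpoly_subst P g * rpoly_subst Q g"
  "rpoly_subst (- P) g = - rpoly_subst P g"
  "rpoly_subst (P - Q) g = rpoly_subst P g - rpoly_subst Q g"
  "rpoly_subst (P ^ k) g = rpoly_subst P g ^ k"
  "rpoly_subst (sum F A) g = (\<Sum>a\<in>A. rpoly_subst (F a) g)"
  "rpoly_subst (rpoly_const c) g = [:c:]"
  "rpoly_subst (rpoly_var i) g = g i"
  "rpoly_subst 0 g = 0"
  "rpoly_subst 1 g = 1"
  by (rule rpoly_subst_eqI; simp add: rpoly_eval_simps poly_rpoly_subst poly_sum)+

subsection \<open>Bivariate polynomials\<close>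

abbreviation const_coeffs :: "'a::comm_ring_1 poly \<Rightarrow> 'a poly poly" where
  "const_coeffs p \<equiv> map_poly (\<lambda>c. [:c:]) p"

text \<open>\<open>p(T) - p(t)\<close>, as a polynomial in \<open>T\<close> whose coefficients are polynomials in \<open>t\<close>\<close>

definition bidiff :: "'a::comm_ring_1 poly \<Rightarrow> 'a poly poly" where
  "bidiff p = const_coeffs p - [:p:]"

lemma const_coeffs_add: "const_coeffs (p + q) = const_coeffs p + const_coeffs q"
  by (intro poly_eqI) (simp add: coeff_map_poly)

lemma const_coeffs_diff: "const_coeffs (p - q) = const_coeffs p - const_coeffs q"
  by (intro poly_eqI) (simp add: coeff_map_poly)

lemma const_coeffs_smult: "const_coeffs (smult a p) = smult [:a:] (const_coeffs p)"
  by (intro poly_eqI) (simp add: coeff_map_poly mult.commute)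

lemma const_coeffs_mult: "const_coeffs (p * q) = const_coeffs p * const_coeffs q"
proof (induction p)
  case (pCons a p)
  have "const_coeffs (pCons 0 (p * q)) = pCons 0 (const_coeffs (p * q))"
    by (subst map_poly_pCons) auto
  with pCons show ?case
    by (simp add: map_poly_pCons const_coeffs_add const_coeffs_smult)
qed simp

lemma poly_const_coeffs_const: "poly (const_coeffs p) [:x:] = [:poly p x:]"
  by (induction p) (auto simp: map_poly_pCons)

lemma poly_const_coeffs_var: "poly (const_coeffs p) [:0, 1:] = p"
  by (induction p) (auto simp: map_poly_pCons)

lemma poly_bidiff_const: "poly (bidiff p) [:x:] = [:poly p x:] - p"
  by (simp add: bidiff_def poly_const_coeffs_const)

lemma poly_bidiff_var: "poly (bidiff p) [:0, 1:] = 0"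
  by (simp add: bidiff_def poly_const_coeffs_var)

lemma coeff_bidiff: "coeff (bidiff p) k = [:coeff p k:] - (if k = 0 then p else 0)"
  by (cases k) (simp_all add: bidiff_def coeff_map_poly)

lemma bidiff_const: "bidiff [:c:] = 0"
  by (simp add: bidiff_def map_poly_pCons)

lemma bidiff_diff: "bidiff (p - q) = bidiff p - bidiff q"
  by (simp add: bidiff_def const_coeffs_diff)

text \<open>A twisted Leibniz rule. It passes divisibility from \<open>bidiff\<close> of a product
  on to \<open>bidiff\<close> of a factor.\<close>

lemma bidiff_mult: "bidiff (p * q) = const_coeffs p * bidiff q + smult q (bidiff p)"
  by (simp add: bidiff_def const_coeffs_mult algebra_simps smult_diff_right)

lemma degree_bidiff: "degree (bidiff p) = degree p"
proof (cases "degree p = 0")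
  case True
  then show ?thesis by (auto elim!: degree_eq_zeroE simp: bidiff_const)
next
  case False
  then have "coeff (bidiff p) (degree p) \<noteq> 0"
    by (auto simp: coeff_bidiff)
  moreover have "degree (bidiff p) \<le> degree p"
    by (intro degree_le) (auto simp: coeff_bidiff coeff_eq_0)
  ultimately show ?thesis
    by (simp add: le_antisym le_degree)
qed

text \<open>Subtracting \<open>p(t)\<close> changes only the coefficient at \<open>0\<close>. So the
  leading coefficient is a nonzero real constant, a unit, which makes \<open>bidiff p\<close>
  primitive and restricts the leading coefficients of its divisors.\<close>

lemma lead_coeff_bidiff:
  "degree p > 0 \<Longrightarrow> lead_coeff (bidiff p) = [:lead_coeff p:]"
  by (simp add: degree_bidiff coeff_bidiff)

section \<open>Gauss's lemma, minimal relations and composition\<close>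

text \<open>Gauss's lemma: over the fraction field \<open>c\<close> is a unit and can be cancelled,
  and divisibility by a primitive polynomial descends from there.\<close>

lemma primitive_part_dvd_of_dvd_smult:
  fixes F G :: "'a::{factorial_ring_gcd, semiring_gcd_mult_normalize} poly"
  assumes "F \<noteq> 0" "c \<noteq> 0" "F dvd smult c G"
  shows "primitive_part F dvd G"
proof (rule fract_poly_dvdD)
  have "primitive_part F dvd F"
    by (metis content_times_primitive_part dvd_smult dvd_refl)
  then have "fract_poly (primitive_part F) dvd fract_poly (smult c G)"
    using assms(3) by (intro fract_poly_dvd) (rule dvd_trans)
  then show "fract_poly (primitive_part F) dvd fract_poly G"
    using assms(2) by (simp add: dvd_smult_iff)
qed (use assms(1) in simp)

text \<open>The content divides the leading coefficient, which is a unit, so \<open>F\<close> is its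
  own primitive part.\<close>

lemma dvd_of_dvd_smult:
  fixes F G :: "real poly poly"
  assumes "lead_coeff F = [:l:]" "l \<noteq> 0" "c \<noteq> 0" "F dvd smult c G"
  shows "F dvd G"
proof -
  have "F \<noteq> 0" using assms(1,2) by auto
  have "content F dvd [:l:]"
    using assms(1) by (metis content_dvd_coeff)
  moreover have "[:l:] dvd 1"
    using assms(2) by (simp add: is_unit_const_poly_iff dvd_field_iff)
  ultimately have "content F = 1"
    using dvd_trans is_unit_content_iff by blast
  then show ?thesis
    using primitive_part_dvd_of_dvd_smult[OF \<open>F \<noteq> 0\<close> assms(3,4)]
    by (simp add: primitive_part_prim)
qed

text \<open>
  \<open>F\<close> plays the role of the minimal polynomial of \<open>a\<close> over the fraction field of the ring \<open>A\<close>; pseudo-division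
  keeps all coefficients in \<open>A\<close>.
\<close>

lemma minimal_relation:
  fixes a :: "'a::idom" and A :: "'a set"
  assumes diff: "\<And>x y. x \<in> A \<Longrightarrow> y \<in> A \<Longrightarrow> x - y \<in> A"
    and mult: "\<And>x y. x \<in> A \<Longrightarrow> y \<in> A \<Longrightarrow> x * y \<in> A"
    and G0: "G0 \<noteq> 0" "\<And>k. coeff G0 k \<in> A" "poly G0 a = 0"
  obtains F where "F \<noteq> 0" "\<And>k. coeff F k \<in> A" "poly F a = 0"
    "\<And>G. (\<And>k. coeff G k \<in> A) \<Longrightarrow> poly G a = 0 \<Longrightarrow> \<exists>c. c \<noteq> 0 \<and> F dvd smult c G"
proof -
  let ?V = "\<lambda>F. F \<noteq> 0 \<and> (\<forall>k. coeff F k \<in> A) \<and> poly F a = 0"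
  obtain F where F: "?V F" and least: "\<And>G. ?V G \<Longrightarrow> degree F \<le> degree G"
    using ex_has_least_nat[of ?V G0 degree] G0 by blast
  have deg_F: "degree F > 0"
    using F by (cases "degree F = 0") (auto elim!: degree_eq_zeroE)
  have "\<exists>c. c \<noteq> 0 \<and> F dvd smult c G" if "\<forall>k. coeff G k \<in> A" "poly G a = 0" for G
    using that
  proof (induction "degree G" arbitrary: G rule: less_induct)
    case less
    show ?case
    proof (cases "G = 0")
      case True
      then show ?thesis by (intro exI[of _ 1]) auto
    next
      case False
      then have le: "degree F \<le> degree G"
        using least less.prems by blast
      \<comment> \<open>One step of pseudo-division: \<open>M\<close> is the multiple of
        \<open>F\<close> that cancels the leading term of \<open>G\<close> scaled by the leading
        coefficient of \<open>F\<close>. No division occurs, so the coefficients of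
        \<open>G'\<close> stay in \<open>A\<close>.\<close>
      define M where "M = monom (lead_coeff G) (degree G - degree F) * F"
      define G' where "G' = smult (lead_coeff F) G - M"
      have coeff_M: "coeff M k = (if k < degree G - degree F then 0
          else lead_coeff G * coeff F (k - (degree G - degree F)))" for k
        by (simp add: M_def coeff_monom_mult)
      have zero: "0 \<in> A"
        using diff[OF G0(2)[of 0] G0(2)[of 0]] by simp
      have "\<forall>k. coeff G' k \<in> A"
        using F less.prems zero by (auto simp: G'_def coeff_M intro!: diff mult)
      moreover have "poly G' a = 0"
        using F less.prems by (simp add: G'_def M_def)
      moreover have "degree G' < degree G" if "G' \<noteq> 0"
      proof (rule degree_less_if_less_eqI)
        have "degree M \<le> degree G"
          using le by (auto simp: M_def intro!: order_trans[OF degree_mult_le]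
              order_trans[OF add_right_mono[OF degree_monom_le]])
        then show "degree G' \<le> degree G"
          by (simp add: G'_def degree_diff_le)
        show "coeff G' (degree G) = 0"
          using le by (auto simp: G'_def coeff_M)
      qed (use that in auto)
      ultimately obtain c where c: "c \<noteq> 0" "F dvd smult c G'"
        using less.hyps by (metis dvd_0_right smult_0_right zero_neq_one)
      have "smult (c * lead_coeff F) G = smult c G' + smult c M"
        by (simp add: G'_def smult_diff_right)
      moreover have "F dvd smult c M"
        by (simp add: M_def dvd_smult)
      ultimately show ?thesis
        using c F by (intro exI[of _ "c * lead_coeff F"]) auto
    qed
  qed
  with F that show ?thesis by blast
qed

text \<open>Induction on the degree, expanding \<open>g\<close> in powers of \<open>h\<close>:
  setting \<open>T = 0\<close> shows that \<open>h - h(0)\<close> divides \<open>g - g(0)\<close>,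
  and the quotient \<open>u\<close> has smaller degree and satisfies the same hypothesis.\<close>

lemma dvd_bidiff_imp_pcompose:
  fixes g h :: "real poly"
  assumes "degree h > 0" "bidiff h dvd bidiff g"
  shows "\<exists>\<gamma>. g = \<gamma> \<circ>\<^sub>p h"
  using assms(2)
proof (induction "degree g" arbitrary: g rule: less_induct)
  case less
  show ?case
  proof (cases "degree g = 0")
    case True
    then obtain c where "g = [:c:]" by (auto elim: degree_eq_zeroE)
    then show ?thesis by (intro exI[of _ "[:c:]"]) simp
  next
    case False
    define h0 where "h0 = h - [:poly h 0:]"
    define g0 where "g0 = g - [:poly g 0:]"
    have deg: "degree h0 = degree h" "degree g0 = degree g"
      unfolding h0_def g0_def
      by (metis degree_pCons_0 add_uminus_conv_diff assms(1) False bot_nat_0.not_eq_extremum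
          degree_add_eq_left degree_minus)+
    have bi: "bidiff h0 = bidiff h" "bidiff g0 = bidiff g"
      by (simp_all add: h0_def g0_def bidiff_diff bidiff_const)
    obtain q where q: "bidiff g = bidiff h * q"
      using less.prems by blast
    have "- g0 = - h0 * poly q [:0:]"
      using arg_cong[OF q, of "\<lambda>F. poly F [:0:]"]
      by (simp add: poly_bidiff_const[of _ 0] h0_def g0_def del: pCons_0_0)
    then obtain u where u: "g0 = u * h0"
      by (metis minus_mult_left mult.commute neg_equal_iff_equal)
    have "u \<noteq> 0" "h0 \<noteq> 0"
      using u deg False by auto
    then have "degree u < degree g"
      using u deg assms(1) by (metis degree_mult_eq less_add_same_cancel1)
    \<comment> \<open>The Leibniz rule for \<open>u * h0\<close> gives this up to the factor
      \<open>h0\<close>, which does not involve \<open>T\<close> and is cancelled by Gauss's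
      lemma.\<close>
    moreover have "bidiff h dvd bidiff u"
    proof (rule dvd_of_dvd_smult)
      show "lead_coeff (bidiff h) = [:lead_coeff h:]" "lead_coeff h \<noteq> 0"
        using assms(1) by (auto simp: lead_coeff_bidiff)
      have "smult h0 (bidiff u) = bidiff g - const_coeffs u * bidiff h"
        using arg_cong[OF u, of bidiff] by (simp add: bidiff_mult bi)
      then show "bidiff h dvd smult h0 (bidiff u)"
        using less.prems by simp
    qed fact
    ultimately obtain \<gamma> where \<gamma>: "u = \<gamma> \<circ>\<^sub>p h"
      using less.hyps by blast
    have "g = [:poly g 0:] + u * (h - [:poly h 0:])"
      using u by (simp add: g0_def h0_def algebra_simps)
    also have "\<dots> = ([:poly g 0:] + \<gamma> * ([:0, 1:] - [:poly h 0:])) \<circ>\<^sub>p h"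
      by (simp add: \<gamma> pcompose_add pcompose_mult pcompose_diff pcompose_pCons pcompose_smult algebra_simps)
    finally show ?thesis by blast
  qed
qed

subsection \<open>Lueroth's theorem for polynomial curves\<close>

lemma dvd_const_imp_dvd_1:
  fixes p :: "'a::field poly"
  assumes "p dvd [:c:]" "c \<noteq> 0"
  shows "p dvd 1"
  using assms dvd_trans is_unit_const_poly_iff by (metis dvd_field_iff)

lemma coeff_poly_const:
  "coeff (poly F [:x:]) s = poly (map_poly (\<lambda>c. coeff c s) F) (x :: 'a::comm_ring_1)"
  by (induction F) (auto simp: map_poly_pCons mult.commute)

text \<open>Comparing degrees in the inner variable \<open>t\<close> shows that the cofactor \<open>q\<close> is a constant.\<close>

lemma bidiff_factor_const:
  fixes D q :: "real poly poly" and h :: "real poly"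
  assumes "degree h > 0" and eq: "bidiff h = D * q"
    and k: "degree (coeff D k) \<ge> degree h"
  shows "bidiff h dvd D"
proof -
  define r where "r = degree (coeff D k)"
  have r_pos: "r > 0" using assms(1) k by (simp add: r_def)
  \<comment> \<open>The coefficient of \<open>t ^ r\<close> in \<open>D\<close>, a nonzero
    polynomial in \<open>T\<close>. Wherever it does not vanish, setting \<open>T = x\<close> leaves
    \<open>D\<close> with degree at least \<open>r \<ge> degree h\<close> in \<open>t\<close>, so
    the cofactor has degree \<open>0\<close> in \<open>t\<close>.\<close>
  define D' where "D' = map_poly (\<lambda>c. coeff c r) D"
  have "coeff D' k \<noteq> 0"
    using r_pos by (auto simp: D'_def coeff_map_poly r_def)
  then have "D' \<noteq> 0" by auto
  have eval: "[:poly h x:] - h = poly D [:x:] * poly q [:x:]" for x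
    using arg_cong[OF eq, of "\<lambda>F. poly F [:x:]"] by (simp add: poly_bidiff_const)
  have deg_q: "degree (poly q [:x:]) = 0" if "poly D' x \<noteq> 0" for x
  proof -
    have "coeff (poly D [:x:]) r \<noteq> 0"
      using that by (simp add: D'_def coeff_poly_const)
    then have "r \<le> degree (poly D [:x:])" "poly D [:x:] \<noteq> 0"
      by (auto intro: le_degree)
    moreover have "degree ([:poly h x:] - h) \<le> degree h"
      by (intro degree_diff_le) auto
    ultimately show ?thesis
      using k degree_mult_eq[of "poly D [:x:]" "poly q [:x:]"] eval[of x]
      by (cases "poly q [:x:] = 0") (auto simp: r_def)
  qed
  \<comment> \<open>The coefficient of \<open>t ^ s\<close> in \<open>q\<close> vanishes at all
    \<open>x\<close> outside the finitely many roots of \<open>D'\<close>.\<close>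
  have q_const: "map_poly (\<lambda>c. coeff c s) q = 0" if "s > 0" for s
  proof (rule ccontr)
    let ?q = "map_poly (\<lambda>c. coeff c s) q"
    assume "?q \<noteq> 0"
    then have "finite ({x. poly ?q x = 0} \<union> {x. poly D' x = 0})"
      using \<open>D' \<noteq> 0\<close> poly_roots_finite by blast
    moreover have "{x. poly ?q x = 0} \<union> {x. poly D' x = 0} = UNIV"
      using deg_q that by (auto simp flip: coeff_poly_const simp: coeff_eq_0)
    ultimately show False
      by (simp add: infinite_UNIV_char_0)
  qed
  define q0 where "q0 = map_poly (\<lambda>c. coeff c 0) q"
  have q: "q = const_coeffs q0"
  proof (intro poly_eqI)
    fix n s
    show "coeff (coeff q n) s = coeff (coeff (const_coeffs q0) n) s"
      using arg_cong[OF q_const[of s], of "\<lambda>p. coeff p n"]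
      by (cases s) (auto simp: q0_def coeff_map_poly)
  qed
  \<comment> \<open>Now \<open>q\<close> involves \<open>T\<close> only. Comparing coefficients of
    \<open>t ^ degree h\<close> shows that \<open>q0\<close> divides a nonzero constant; the sign
    comes from \<open>-h(t)\<close> in \<open>bidiff h\<close>.\<close>
  define E where "E = - map_poly (\<lambda>c. coeff c (degree h)) D"
  have "poly [:lead_coeff h:] x = poly (E * q0) x" for x
  proof -
    have "coeff ([:poly h x:] - h) (degree h) = - lead_coeff h"
      using assms(1) by (cases "degree h") auto
    then have "- lead_coeff h = coeff (poly D [:x:]) (degree h) * poly q0 x"
      unfolding eval q poly_const_coeffs_const by (simp add: mult.commute)
    then show ?thesis
      by (simp add: E_def coeff_poly_const)
  qed
  then have "[:lead_coeff h:] = E * q0"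
    using poly_eq_poly_eq_iff by blast
  then have "q0 dvd [:lead_coeff h:]"
    by simp
  moreover have "lead_coeff h \<noteq> 0"
    using assms(1) by auto
  ultimately have "q0 dvd 1"
    by (rule dvd_const_imp_dvd_1)
  then obtain c where "q0 = [:c:]" "c \<noteq> 0"
    unfolding is_unit_poly_iff by (metis not_is_unit_0)
  then have "D = bidiff h * [:[:inverse c:]:]"
    using eq q by (simp add: map_poly_pCons pCons_one)
  then show ?thesis by (metis dvd_triv_left)
qed



text \<open>The generator \<open>h\<close> is a nonconstant coefficient of the primitive part
  \<open>D\<close> of the minimal relation of \<open>t\<close> over \<open>A\<close>. It is a
  quotient of elements of \<open>A\<close>, so \<open>D\<close> divides \<open>bidiff h\<close>;
  comparing degrees in \<open>t\<close> gives the converse. Hence \<open>bidiff h\<close> divides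
  every \<open>bidiff (g i)\<close>, and \<open>g i\<close> is a polynomial in
  \<open>h\<close>.\<close>

lemma polynomial_Lueroth:
  fixes g :: "'v \<Rightarrow> real poly"
  assumes "degree (g i\<^sub>0) > 0"
  obtains h \<gamma> a b where "rpoly_subst b g \<noteq> 0" "rpoly_subst b g * h = rpoly_subst a g"
    "\<And>i. g i = \<gamma> i \<circ>\<^sub>p h"
proof -
  define A where "A = range (\<lambda>P. rpoly_subst P g)"
  have A_diff: "x - y \<in> A" and A_mult: "x * y \<in> A" if "x \<in> A" "y \<in> A" for x y
    using that unfolding A_def by (auto simp flip: rpoly_subst_simps(2,4))
  have A_const: "[:c:] \<in> A" for c
    unfolding A_def by (metis rangeI rpoly_subst_simps(7))
  have A_var: "g i \<in> A" for i
    unfolding A_def by (metis rangeI rpoly_subst_simps(8))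
  have A_zero: "0 \<in> A"
    using A_const[of 0] by simp
  have A_bidiff: "coeff (bidiff (g i)) k \<in> A" for i k
    by (auto simp: coeff_bidiff intro!: A_diff A_const A_var A_zero)
  have "bidiff (g i\<^sub>0) \<noteq> 0"
    using degree_bidiff[of "g i\<^sub>0"] assms by auto
  then obtain F where "F \<noteq> 0" and F_A: "\<And>k. coeff F k \<in> A" and F_root: "poly F [:0, 1:] = 0"
    and F_min: "\<And>G. (\<And>k. coeff G k \<in> A) \<Longrightarrow> poly G [:0, 1:] = 0 \<Longrightarrow>
        \<exists>c. c \<noteq> 0 \<and> F dvd smult c G"
    using minimal_relation[of A "bidiff (g i\<^sub>0)" "[:0, 1:]"] A_diff A_mult A_bidiff poly_bidiff_var
    by metis
  \<comment> \<open>\<open>F\<close> is a minimal polynomial of \<open>t\<close> over the fraction field of \<open>A\<close>, so the coefficients of its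
    primitive part lie in \<open>\<real>[t]\<close> and, up to a constant, in that fraction field.\<close>
  define D where "D = primitive_part F"
  have F: "F = smult (content F) D"
    by (simp add: D_def)
  then have "content F \<noteq> 0" and "D \<noteq> 0"
    using \<open>F \<noteq> 0\<close> by auto
  have D_dvd: "D dvd G" if "c \<noteq> 0" "F dvd smult c G" for c G
    unfolding D_def using \<open>F \<noteq> 0\<close> that by (rule primitive_part_dvd_of_dvd_smult)
  have D_dvd_g: "D dvd bidiff (g i)" for i
    using F_min[of "bidiff (g i)"] A_bidiff poly_bidiff_var D_dvd by blast
  \<comment> \<open>\<open>D\<close> divides \<open>bidiff (g i\<^sub>0)\<close>, whose leading
    coefficient is a nonzero constant.\<close>
  obtain l where l: "lead_coeff D = [:l:]" "l \<noteq> 0"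
  proof -
    obtain q where "bidiff (g i\<^sub>0) = D * q"
      using D_dvd_g by blast
    then have "lead_coeff D dvd [:lead_coeff (g i\<^sub>0):]"
      using lead_coeff_bidiff[OF assms] by (metis dvd_triv_left lead_coeff_mult)
    moreover have "lead_coeff (g i\<^sub>0) \<noteq> 0"
      using assms by auto
    ultimately have "lead_coeff D dvd 1"
      by (rule dvd_const_imp_dvd_1)
    with that show ?thesis unfolding is_unit_poly_iff by (metis not_is_unit_0)
  qed
  \<comment> \<open>Otherwise \<open>t\<close> would be a root of a nonzero polynomial with real
    coefficients.\<close>
  have "\<exists>k. degree (coeff D k) > 0"
  proof (rule ccontr)
    assume "\<not> ?thesis"
    then have "coeff D n = [:coeff (coeff D n) 0:]" for n
      by (metis degree_0_id not_gr_zero)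
    then have "D = const_coeffs (map_poly (\<lambda>c. coeff c 0) D)"
      by (intro poly_eqI[of D]) (simp add: coeff_map_poly)
    then show False
      using F F_root \<open>D \<noteq> 0\<close> \<open>content F \<noteq> 0\<close>
      by (metis map_poly_0 mult_eq_0_iff poly_const_coeffs_var poly_smult)
  qed
  then obtain k where k: "degree (coeff D k) > 0" by blast
  define h where "h = coeff D k"
  \<comment> \<open>The coefficients of \<open>F\<close> are those of \<open>D\<close> times
    \<open>content F\<close>. This factor cancels in the quotient of two of them, which presents
    \<open>h\<close> as a quotient of elements of \<open>A\<close>.\<close>
  obtain b where b: "rpoly_subst b g = lead_coeff F"
    using F_A[of "degree F"] by (auto simp: A_def)
  obtain a' where a': "rpoly_subst a' g = coeff F k"
    using F_A[of k] by (auto simp: A_def)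
  have "lead_coeff F = content F * [:l:]"
    using F l by (metis lead_coeff_smult)
  moreover have "coeff F k = content F * h"
    using F unfolding h_def by (metis coeff_smult)
  ultimately have ba: "rpoly_subst b g * h = rpoly_subst (rpoly_const l * a') g"
    by (simp add: b a')
  have b0: "rpoly_subst b g \<noteq> 0"
    using b \<open>F \<noteq> 0\<close> by simp
  \<comment> \<open>After multiplication by the denominator, \<open>h(T) - h(t)\<close> has its
    coefficients in \<open>A\<close> and the root \<open>T = t\<close>, so the minimality of
    \<open>F\<close> applies.\<close>
  have "D dvd bidiff h"
  proof -
    have "rpoly_subst b g * [:c:] \<in> A" for c
      by (intro A_mult A_const) (auto simp: A_def)
    moreover have "rpoly_subst b g * h \<in> A"
      unfolding ba A_def by (rule rangeI)
    ultimately have "coeff (smult (rpoly_subst b g) (bidiff h)) k \<in> A" for k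
      using A_diff A_zero by (auto simp: coeff_bidiff right_diff_distrib simp del: mult_pCons_right)
    moreover have "poly (smult (rpoly_subst b g) (bidiff h)) [:0, 1:] = 0"
      by (simp add: poly_bidiff_var)
    ultimately obtain c where "c \<noteq> 0" "F dvd smult c (smult (rpoly_subst b g) (bidiff h))"
      using F_min by blast
    then show ?thesis
      using D_dvd[of "c * rpoly_subst b g"] b0 by simp
  qed
  then obtain q where "bidiff h = D * q" by blast
  then have "bidiff h dvd D"
    using k by (intro bidiff_factor_const[of _ _ _ k]) (auto simp: h_def)
  then have "\<exists>\<gamma>. g i = \<gamma> \<circ>\<^sub>p h" for i
    using D_dvd_g k by (intro dvd_bidiff_imp_pcompose) (auto simp: h_def intro: dvd_trans)
  then obtain \<gamma> where "\<And>i. g i = \<gamma> i \<circ>\<^sub>p h" by metis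
  with that b0 ba show ?thesis by blast
qed



section \<open>Transfer of the parametrization to other curves\<close>

text \<open>The equation says \<open>\<gamma>(p/q) = w\<close> with denominators cleared. So
  \<open>p/q\<close> is integral over the polynomial ring, which is integrally closed; the proof is
  the rational root argument in lowest terms.\<close>

lemma polynomial_of_integral_quotient:
  fixes p q \<gamma> w :: "real poly"
  assumes "q \<noteq> 0" "degree \<gamma> > 0"
    and eq: "(\<Sum>k\<le>degree \<gamma>. smult (coeff \<gamma> k) (p ^ k * q ^ (degree \<gamma> - k))) = w * q ^ degree \<gamma>"
  shows "q dvd p"
proof -
  let ?N = "degree \<gamma>"
  define d where "d = gcd p q"
  have "d \<noteq> 0" using assms(1) by (simp add: d_def)
  obtain p' q' where p': "p = d * p'" and q': "q = d * q'" and cop: "coprime p' q'"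
    using gcd_coprime_exists[of p q] \<open>d \<noteq> 0\<close> unfolding d_def by (metis mult.commute)
  have "d ^ ?N * (\<Sum>k\<le>?N. smult (coeff \<gamma> k) (p' ^ k * q' ^ (?N - k))) =
      (\<Sum>k\<le>?N. smult (coeff \<gamma> k) (p ^ k * q ^ (?N - k)))"
    unfolding sum_distrib_left
  proof (rule sum.cong)
    fix k assume "k \<in> {..?N}"
    then have "d ^ ?N = d ^ k * d ^ (?N - k)"
      by (simp flip: power_add)
    then show "d ^ ?N * smult (coeff \<gamma> k) (p' ^ k * q' ^ (?N - k)) =
        smult (coeff \<gamma> k) (p ^ k * q ^ (?N - k))"
      unfolding p' q' power_mult_distrib by (simp add: mult_ac)
  qed simp
  also have "\<dots> = d ^ ?N * (w * q' ^ ?N)"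
    unfolding eq unfolding q' power_mult_distrib by (simp only: mult_ac)
  finally have eq': "(\<Sum>k\<le>?N. smult (coeff \<gamma> k) (p' ^ k * q' ^ (?N - k))) = w * q' ^ ?N"
    using \<open>d \<noteq> 0\<close> by simp
  \<comment> \<open>Every term of the sum except the top one contains a factor \<open>q'\<close>,
    and so does the right-hand side because \<open>?N > 0\<close>.\<close>
  have "q' dvd smult (lead_coeff \<gamma>) (p' ^ ?N)"
  proof -
    have "smult (lead_coeff \<gamma>) (p' ^ ?N) =
        w * q' ^ ?N - (\<Sum>k<?N. smult (coeff \<gamma> k) (p' ^ k * q' ^ (?N - k)))"
      unfolding eq'[symmetric] by (simp flip: lessThan_Suc_atMost)
    moreover have "q' dvd (\<Sum>k<?N. smult (coeff \<gamma> k) (p' ^ k * q' ^ (?N - k)))"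
      by (intro dvd_sum dvd_smult dvd_mult dvd_power) auto
    moreover have "q' dvd w * q' ^ ?N"
      using assms(2) by (intro dvd_mult dvd_power) auto
    ultimately show ?thesis by simp
  qed
  then have "q' dvd p' ^ ?N"
    using assms(2) by (metis dvd_smult_cancel leading_coeff_0_iff degree_0 less_irrefl)
  then have "q' dvd 1"
    using cop coprime_common_divisor[of "p' ^ ?N" q'] by (simp add: coprime_power_left_iff)
  then show ?thesis
    unfolding p' q' by (rule mult_dvd_mono[OF dvd_refl unit_imp_dvd])
qed

text \<open>The homogenization of \<open>\<gamma>\<close> at the pair \<open>(B * h, B)\<close>. It
  turns a relation with cleared denominators back into a composition.\<close>

lemma pcompose_homogenize:
  fixes \<gamma> h B :: "real poly"
  shows "(\<Sum>k\<le>degree \<gamma>. smult (coeff \<gamma> k) ((B * h) ^ k * B ^ (degree \<gamma> - k))) =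
    (\<gamma> \<circ>\<^sub>p h) * B ^ degree \<gamma>"
proof (rule poly_eq_poly_eq_iff[THEN iffD1], rule ext)
  fix x
  have "poly B x ^ degree \<gamma> = poly B x ^ k * poly B x ^ (degree \<gamma> - k)" if "k \<le> degree \<gamma>" for k
    using that by (simp flip: power_add)
  then show "poly (\<Sum>k\<le>degree \<gamma>. smult (coeff \<gamma> k) ((B * h) ^ k * B ^ (degree \<gamma> - k))) x =
      poly ((\<gamma> \<circ>\<^sub>p h) * B ^ degree \<gamma>) x"
    by (simp add: poly_sum poly_pcompose poly_altdef[of \<gamma>] sum_distrib_right power_mult_distrib)
      (intro sum.cong, auto)
qed

text \<open>Equal vanishing ideals keep \<open>b\<close> nonzero along \<open>g'\<close>, so
  \<open>a/b\<close> is a rational function there. Its value under the nonconstant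
  \<open>\<gamma> i\<^sub>0\<close> is the polynomial \<open>g' i\<^sub>0\<close>; hence it is
  integral, and so a polynomial \<open>h'\<close>. That \<open>a\<close> and \<open>b\<close> do not
  depend on \<open>g'\<close> makes the parameters of different curves comparable.\<close>

lemma polynomial_parametrization_factors:
  fixes g g' :: "'v \<Rightarrow> real poly"
  assumes b: "rpoly_subst b g \<noteq> 0" "rpoly_subst b g * h = rpoly_subst a g"
    and g: "\<And>i. g i = \<gamma> i \<circ>\<^sub>p h" and nonconst: "degree (g i\<^sub>0) > 0"
    and same: "\<And>P. rpoly_subst P g = 0 \<longleftrightarrow> rpoly_subst P g' = 0"
  obtains h' where "rpoly_subst b g' * h' = rpoly_subst a g'" "\<And>i. g' i = \<gamma> i \<circ>\<^sub>p h'"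
proof -
  \<comment> \<open>\<open>g\<^sub>i = \<gamma>\<^sub>i(a/b)\<close> with denominators cleared, a relation between the coordinates that \<open>g'\<close> inherits\<close>
  define rel where "rel i = (\<Sum>k\<le>degree (\<gamma> i). rpoly_const (coeff (\<gamma> i) k) * (a ^ k * b ^ (degree (\<gamma> i) - k)))
      - rpoly_var i * b ^ degree (\<gamma> i)" for i
  have rel: "rpoly_subst (rel i) G = (\<Sum>k\<le>degree (\<gamma> i). smult (coeff (\<gamma> i) k)
      (rpoly_subst a G ^ k * rpoly_subst b G ^ (degree (\<gamma> i) - k)))
      - G i * rpoly_subst b G ^ degree (\<gamma> i)" for i and G :: "'v \<Rightarrow> real poly"
    by (simp add: rel_def)
  have "rpoly_subst (rel i) g = 0" for i
    unfolding rel b(2)[symmetric] pcompose_homogenize by (simp add: g)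
  then have "rpoly_subst (rel i) g' = 0" for i
    using same by blast
  then have rel': "(\<Sum>k\<le>degree (\<gamma> i). smult (coeff (\<gamma> i) k)
      (rpoly_subst a g' ^ k * rpoly_subst b g' ^ (degree (\<gamma> i) - k)))
      = g' i * rpoly_subst b g' ^ degree (\<gamma> i)" for i
    unfolding rel by simp
  have b': "rpoly_subst b g' \<noteq> 0"
    using b(1) same by blast
  have "degree (\<gamma> i\<^sub>0) > 0"
    using nonconst unfolding g[of i\<^sub>0] by (simp add: degree_pcompose)
  then have "rpoly_subst b g' dvd rpoly_subst a g'"
    using polynomial_of_integral_quotient[OF b' _ rel'] by blast
  then obtain h' where h': "rpoly_subst a g' = rpoly_subst b g' * h'" ..
  have "g' i = \<gamma> i \<circ>\<^sub>p h'" for i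
    using rel'[of i] b' unfolding h' pcompose_homogenize by simp
  with h' that show ?thesis by metis
qed

subsection \<open>Krull dimension and vanishing ideals of curves\<close>

text \<open>An ideal containing \<open>I\<close> is the union of its cosets modulo
  \<open>I\<close>.\<close>

lemma (in ring) quot_coset_mem_image_iff:
  assumes "ideal I R" "ideal J R" "I \<subseteq> J" "a \<in> carrier R"
  shows "I +> a \<in> (+>) I ` J \<longleftrightarrow> a \<in> J"
proof -
  have "ideal ((+>) I ` J) (R Quot I)"
    using assms by (intro ring_ideal_imp_quot_ideal)
  then have "a \<in> \<Union> ((+>) I ` J) \<longleftrightarrow> I +> a \<in> (+>) I ` J"
    using assms by (intro canonical_proj_vimage_mem_iff) (auto dest: ideal.Icarr)
  moreover have "\<Union> ((+>) I ` J) = J"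
    using assms ideal_incl_iff by simp
  ultimately show ?thesis by simp
qed

lemma (in cring) primeideal_quot:
  assumes "ideal I R" "primeideal J R" "I \<subseteq> J"
  shows "primeideal ((+>) I ` J) (R Quot I)"
proof (rule primeidealI)
  interpret I: ideal I R by fact
  interpret J: primeideal J R by fact
  have J: "ideal J R" by (rule J.is_ideal)
  note mem = quot_coset_mem_image_iff[OF assms(1) J assms(3)]
  show "ideal ((+>) I ` J) (R Quot I)"
    using assms(1) J by (rule ring_ideal_imp_quot_ideal)
  show "cring (R Quot I)"
    using I.quotient_is_cring is_cring .
  have carrier: "carrier (R Quot I) = (+>) I ` carrier R"
    unfolding FactRing_def A_RCOSETS_def' by auto
  show "carrier (R Quot I) \<noteq> (+>) I ` J"
  proof
    obtain c where c: "c \<in> carrier R" "c \<notin> J"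
      using J.I_notcarr J.Icarr by blast
    assume "carrier (R Quot I) = (+>) I ` J"
    then have "I +> c \<in> (+>) I ` J"
      using c(1) unfolding carrier by blast
    then show False
      using mem c by simp
  qed
  fix x y
  assume "x \<in> carrier (R Quot I)" "y \<in> carrier (R Quot I)"
    and xy: "x \<otimes>\<^bsub>R Quot I\<^esub> y \<in> (+>) I ` J"
  then obtain a b where a: "a \<in> carrier R" "x = I +> a" and b: "b \<in> carrier R" "y = I +> b"
    unfolding carrier by auto
  have "x \<otimes>\<^bsub>R Quot I\<^esub> y = I +> (a \<otimes> b)"
    using a b by (simp add: FactRing_def I.rcoset_mult_add)
  then have "a \<otimes> b \<in> J"
    using xy mem[of "a \<otimes> b"] a b by simp
  then show "x \<in> (+>) I ` J \<or> y \<in> (+>) I ` J"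
    using J.I_prime[OF a(1) b(1)] mem[OF a(1)] mem[OF b(1)] a(2) b(2) by blast
qed

text \<open>By the correspondence of ideals, chains of primes for the quotient can be exhibited in
  \<open>R\<close> itself.\<close>

lemma (in cring) chain_le_krull_dim_quot:
  assumes "ideal I R" "\<And>i. i \<le> d \<Longrightarrow> primeideal (Q i) R" "\<And>i. i < d \<Longrightarrow> Q i \<subset> Q (Suc i)"
    "\<And>i. i \<le> d \<Longrightarrow> I \<subseteq> Q i"
  shows "enat d \<le> krull_dim (R Quot I)"
proof -
  have ideal: "ideal (Q i) R" if "i \<le> d" for i
    using assms(2)[OF that] by (rule primeideal.axioms(1))
  have "primeideal ((+>) I ` Q i) (R Quot I)" if "i \<le> d" for i
    using assms(1) assms(2)[OF that] assms(4)[OF that] by (rule primeideal_quot)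
  moreover have "(+>) I ` Q i \<subset> (+>) I ` Q (Suc i)" if i: "i < d" for i
  proof -
    obtain a where a: "a \<in> Q (Suc i)" "a \<notin> Q i"
      using assms(3)[OF i] by blast
    then have "a \<in> carrier R"
      using ideal.Icarr[OF ideal[of "Suc i"]] i by simp
    then have "I +> a \<notin> (+>) I ` Q i"
      using quot_coset_mem_image_iff[OF assms(1) ideal[of i] assms(4)[of i]] a(2) i by auto
    then show ?thesis
      using assms(3)[OF i] a(1) by blast
  qed
  ultimately show ?thesis
    unfolding krull_dim_def
    by (intro Sup_upper CollectI exI[of _ d] conjI exI[of _ "\<lambda>i. (+>) I ` Q i"]) auto
qed

lemma (in field) krull_dim_field: "krull_dim R = 0"
proof -
  have "d = 0" if "\<forall>i\<le>d. primeideal (Q i) R" "\<forall>i<d. Q i \<subset> Q (Suc i)" for d and Q :: "nat \<Rightarrow> 'a set"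
  proof (rule ccontr)
    assume "d \<noteq> 0"
    then have Q: "primeideal (Q 0) R" "primeideal (Q 1) R" "Q 0 \<subset> Q 1"
      using that by auto
    have "Q j = {\<zero>}" if "primeideal (Q j) R" for j
      using that all_ideals primeideal.axioms(1)[OF that] primeideal.I_notcarr[OF that] by blast
    with Q show False by blast
  qed
  then have "krull_dim R \<le> 0"
    unfolding krull_dim_def by (intro Sup_least) (auto simp: zero_enat_def)
  then show ?thesis by simp
qed

lemma ideal_vanishing_ideal:
  "ideal (vanishing_ideal S) (ring_of_type_algebra :: 'm::finite rpoly ring)" (is "ideal _ ?R")
proof -
  interpret cring ?R by (rule cring_from_type_algebra)
  have minus: "\<ominus>\<^bsub>?R\<^esub> P = - P" for P
    by (rule minus_equality) (auto simp: ring_of_type_algebra_def)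
  show ?thesis
  proof (intro idealI add.subgroupI)
    show "ring ?R" ..
  next
    have "0 \<in> vanishing_ideal S" by (simp add: vanishing_ideal_def)
    then show "vanishing_ideal S \<noteq> {}" by blast
  qed (auto simp: minus minus[unfolded a_inv_def] vanishing_ideal_def rpoly_eval_simps,
       auto simp: vanishing_ideal_def rpoly_eval_simps ring_of_type_algebra_def)
qed

section \<open>Polynomial curves and their vanishing ideals\<close>

definition poly_curve :: "('m \<Rightarrow> real poly) \<Rightarrow> real \<Rightarrow> real ^ 'm" where
  "poly_curve g s = (\<chi> j. poly (g j) s)"

lemma rpoly_eval_poly_curve: "rpoly_eval P (($) (poly_curve g s)) = poly (rpoly_subst P g) s"
proof -
  have "($) (poly_curve g s) = (\<lambda>i. poly (g i) s)"
    by (simp add: fun_eq_iff poly_curve_def)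
  then show ?thesis by (simp add: poly_rpoly_subst)
qed

lemma vanishing_ideal_poly_curve:
  "P \<in> vanishing_ideal (range (poly_curve g)) \<longleftrightarrow> rpoly_subst P g = 0"
  unfolding vanishing_ideal_def
  by (auto simp: rpoly_eval_poly_curve poly_all_0_iff_0)

text \<open>If \<open>P\<close> is nonzero at \<open>x\<close> and \<open>Q\<close> at
  \<open>y\<close>, then neither vanishes identically on a curve in \<open>S\<close> through both
  points. Their product does, although polynomials in one variable form a domain.\<close>

lemma primeideal_vanishing_ideal:
  fixes S :: "(real ^ 'm) set"
  assumes "S \<noteq> {}"
    and conn: "\<And>x y. x \<in> S \<Longrightarrow> y \<in> S \<Longrightarrow> \<exists>g. {x, y} \<subseteq> range (poly_curve g) \<and> range (poly_curve g) \<subseteq> S"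
  shows "primeideal (vanishing_ideal S) (ring_of_type_algebra :: 'm rpoly ring)" (is "primeideal _ ?R")
proof (rule primeidealI[OF ideal_vanishing_ideal cring_from_type_algebra])
  have "1 \<notin> vanishing_ideal S"
    using assms(1) by (auto simp: vanishing_ideal_def)
  then show "carrier ?R \<noteq> vanishing_ideal S"
    by (auto simp: ring_of_type_algebra_def)
  fix P Q assume "P \<otimes>\<^bsub>?R\<^esub> Q \<in> vanishing_ideal S"
  then have PQ: "P * Q \<in> vanishing_ideal S"
    by (simp add: ring_of_type_algebra_def)
  show "P \<in> vanishing_ideal S \<or> Q \<in> vanishing_ideal S"
  proof (rule ccontr)
    assume "\<not> ?thesis"
    then obtain x y where "x \<in> S" "rpoly_eval P (($) x) \<noteq> 0" "y \<in> S" "rpoly_eval Q (($) y) \<noteq> 0"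
      by (auto simp: vanishing_ideal_def)
    with conn obtain g where g: "{x, y} \<subseteq> range (poly_curve g)" "range (poly_curve g) \<subseteq> S"
      by blast
    then have "P * Q \<in> vanishing_ideal (range (poly_curve g))"
      using PQ by (auto simp: vanishing_ideal_def)
    then have "rpoly_subst P g = 0 \<or> rpoly_subst Q g = 0"
      by (simp add: vanishing_ideal_poly_curve)
    then show False
      using g(1) \<open>rpoly_eval P (($) x) \<noteq> 0\<close> \<open>rpoly_eval Q (($) y) \<noteq> 0\<close>
      by (auto simp: rpoly_eval_poly_curve)
  qed
qed

lemma primeideal_vanishing_ideal_curve:
  "primeideal (vanishing_ideal (range (poly_curve g))) (ring_of_type_algebra :: 'm::finite rpoly ring)"
  by (rule primeideal_vanishing_ideal) blast+

lemma maximalideal_vanishing_ideal_singleton: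
  fixes y :: "real ^ 'm"
  shows "maximalideal (vanishing_ideal {y}) (ring_of_type_algebra :: 'm rpoly ring)" (is "maximalideal _ ?R")
proof (rule maximalidealI[OF ideal_vanishing_ideal])
  show "carrier ?R \<noteq> vanishing_ideal {y}"
  proof -
    have "1 \<notin> vanishing_ideal {y}" by (simp add: vanishing_ideal_def)
    then show ?thesis by (auto simp: ring_of_type_algebra_def)
  qed
  fix J assume J: "ideal J ?R" "vanishing_ideal {y} \<subseteq> J" "J \<subseteq> carrier ?R"
  show "J = vanishing_ideal {y} \<or> J = carrier ?R"
  proof (cases "J = vanishing_ideal {y}")
    case False
    then obtain P where P: "P \<in> J" "rpoly_eval P (($) y) \<noteq> 0"
      using J(2) by (auto simp: vanishing_ideal_def)
    interpret J: ideal J ?R by fact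
    \<comment> \<open>Scaled to take the value \<open>1\<close> at \<open>y\<close>, so that
      \<open>1 - ?P\<close> vanishes there and \<open>1\<close> lies in \<open>J\<close>.\<close>
    let ?P = "rpoly_const (inverse (rpoly_eval P (($) y))) * P"
    have "?P \<in> J"
      using J.I_l_closed[OF P(1)] by (simp add: ring_of_type_algebra_def)
    moreover have "1 - ?P \<in> J"
      using J(2) P(2) by (auto simp: vanishing_ideal_def rpoly_eval_simps)
    ultimately have "?P \<oplus>\<^bsub>?R\<^esub> (1 - ?P) \<in> J"
      by (rule additive_subgroup.a_closed[OF ideal.axioms(1)[OF J(1)]])
    then have "\<one>\<^bsub>?R\<^esub> \<in> J"
      by (simp add: ring_of_type_algebra_def)
    then show ?thesis
      using J.one_imp_carrier by blast
  qed simp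
qed

text \<open>The coordinate ring of a point is a field. This later rules out that \<open>S\<close> is
  a single point.\<close>

lemma semialgebraic_dim_singleton: "semialgebraic_dim {y :: real ^ 'm} = 0"
  unfolding semialgebraic_dim_def
  by (intro field.krull_dim_field maximalideal.quotient_is_field
      maximalideal_vanishing_ideal_singleton cring_from_type_algebra)

text \<open>Otherwise the ideals of \<open>S\<close>, of the curve and of a point on it form a
  strict chain of three primes, and the dimension is at least \<open>2\<close>.\<close>

lemma vanishing_ideal_curve_eq:
  fixes S :: "(real ^ 'm) set"
  assumes dim: "semialgebraic_dim S = 1"
    and prime: "primeideal (vanishing_ideal S) (ring_of_type_algebra :: 'm rpoly ring)"
    and sub: "range (poly_curve g) \<subseteq> S" and nonconst: "degree (g i) > 0"
  shows "vanishing_ideal (range (poly_curve g)) = vanishing_ideal S"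
proof (rule ccontr)
  assume ne: "\<not> ?thesis"
  let ?R = "ring_of_type_algebra :: 'm rpoly ring"
  let ?y = "poly_curve g 0"
  \<comment> \<open>Only the indices \<open>0\<close>, \<open>1\<close>, \<open>2\<close> enter the
    chain. Repeating the ideal of the point beyond them makes every \<open>Q k\<close>
    prime.\<close>
  define Q where "Q k = (if k = 0 then vanishing_ideal S else
      if k = 1 then vanishing_ideal (range (poly_curve g)) else vanishing_ideal {?y})" for k :: nat
  have "vanishing_ideal S \<subset> vanishing_ideal (range (poly_curve g))"
    using ne sub by (auto simp: vanishing_ideal_def)
  moreover have "vanishing_ideal (range (poly_curve g)) \<subset> vanishing_ideal {?y}"
  proof -
    let ?P = "rpoly_var i - rpoly_const (poly (g i) 0)"
    have "?P \<in> vanishing_ideal {?y}"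
      by (simp add: vanishing_ideal_def rpoly_eval_simps poly_curve_def)
    moreover have "g i \<noteq> [:poly (g i) 0:]"
      using nonconst by (metis degree_pCons_0 less_irrefl)
    then have "?P \<notin> vanishing_ideal (range (poly_curve g))"
      by (simp add: vanishing_ideal_poly_curve)
    moreover have "vanishing_ideal (range (poly_curve g)) \<subseteq> vanishing_ideal {?y}"
      by (auto simp: vanishing_ideal_def)
    ultimately show ?thesis by blast
  qed
  ultimately have chain: "Q k \<subset> Q (Suc k)" if "k < 2" for k
    using that by (auto simp: Q_def less_2_cases_iff)
  \<comment> \<open>The ideal of the point is treated as that of a constant curve.\<close>
  have "primeideal (Q k) ?R" for k
    using prime primeideal_vanishing_ideal_curve[of g]
      primeideal_vanishing_ideal_curve[of "\<lambda>j. [:poly (g j) 0:]"]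
    by (simp add: Q_def poly_curve_def image_constant_conv)
  moreover have "vanishing_ideal S \<subseteq> Q k" for k
    using sub by (auto simp: Q_def vanishing_ideal_def)
  ultimately have "enat 2 \<le> krull_dim (?R Quot vanishing_ideal S)"
    using chain cring.chain_le_krull_dim_quot[OF cring_from_type_algebra ideal_vanishing_ideal]
    by blast
  then show False
    using dim by (simp add: semialgebraic_dim_def one_enat_def)
qed

subsection \<open>Images of polynomial maps\<close>

lemma poly_curve_pcompose: "poly_curve (\<lambda>j. \<gamma> j \<circ>\<^sub>p q) s = poly_curve \<gamma> (poly q s)"
  by (simp add: poly_curve_def poly_pcompose)

lemma poly_curve_constant:
  assumes "\<And>j. degree (g j) = 0"
  shows "poly_curve g s = poly_curve g t"
proof -
  have "poly (g j) s = poly (g j) t" for j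
    using assms[of j] by (auto elim!: degree_eq_zeroE)
  then show ?thesis by (simp add: poly_curve_def)
qed

lemma continuous_on_poly_curve: "continuous_on A (poly_curve g)"
  unfolding poly_curve_def by (intro continuous_intros)

lemma polynomial_map_line:
  fixes f :: "(nat \<Rightarrow> real) \<Rightarrow> real ^ 'm"
  assumes "polynomial_map n f"
    and "p \<in> topspace (Euclidean_space n)" "v \<in> topspace (Euclidean_space n)"
  obtains g where "\<And>s. f (\<lambda>i. p i + s * v i) = poly_curve g s"
proof -
  obtain P where P: "\<And>j x. x \<in> topspace (Euclidean_space n) \<Longrightarrow> f x $ j = rpoly_eval (P j) x"
    using assms(1) unfolding polynomial_map_def by metis
  have "f (\<lambda>i. p i + s * v i) = poly_curve (\<lambda>j. rpoly_subst (P j) (\<lambda>i. [:p i, v i:])) s" for s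
  proof -
    have "(\<lambda>i. p i + s * v i) \<in> topspace (Euclidean_space n)"
      using assms(2,3) by (simp add: topspace_Euclidean_space)
    then show ?thesis
      by (simp add: vec_eq_iff P poly_curve_def poly_rpoly_subst)
  qed
  with that show ?thesis by blast
qed

text \<open>Translates between the general encoding of polynomial maps and univariate polynomials:
  \<open>Euclidean_space 1\<close> is the line spanned by the first unit vector.\<close>

lemma polynomial_image_1_iff:
  fixes S :: "(real ^ 'm) set"
  shows "polynomial_image 1 S \<longleftrightarrow> (\<exists>g. S = range (poly_curve g))"
proof
  assume "polynomial_image 1 S"
  then obtain f where f: "polynomial_map 1 f" and S: "S = f ` topspace (Euclidean_space 1)"
    unfolding polynomial_image_def by blast
  define v :: "nat \<Rightarrow> real" where "v i = (if i = 0 then 1 else 0)" for i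
  have zero: "(\<lambda>_. 0) \<in> topspace (Euclidean_space 1)" and v: "v \<in> topspace (Euclidean_space 1)"
    by (simp_all add: topspace_Euclidean_space v_def)
  obtain g where g: "\<And>s. f (\<lambda>i. 0 + s * v i) = poly_curve g s"
    using polynomial_map_line[OF f zero v] by blast
  have "topspace (Euclidean_space 1) = range (\<lambda>s i. 0 + s * v i)"
  proof (intro equalityI subsetI)
    fix x :: "nat \<Rightarrow> real" assume "x \<in> topspace (Euclidean_space 1)"
    then have "x i = 0 + x 0 * v i" for i
      by (cases i) (simp_all add: topspace_Euclidean_space v_def)
    then have "x = (\<lambda>i. 0 + x 0 * v i)" by (rule ext)
    then show "x \<in> range (\<lambda>s i. 0 + s * v i)" by (rule range_eqI)
  qed (auto simp: topspace_Euclidean_space v_def)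
  then have "S = range (poly_curve g)"
    unfolding S by (simp only: image_image g)
  then show "\<exists>g. S = range (poly_curve g)" by (rule exI[of _ g])
next
  assume "\<exists>g. S = range (poly_curve g)"
  then obtain g where S: "S = range (poly_curve g)" ..
  define P :: "'m \<Rightarrow> nat rpoly" where
    "P j = (\<Sum>k\<le>degree (g j). Poly_Mapping.single (Poly_Mapping.single 0 k) (coeff (g j) k))" for j
  have "P j \<in> rpolys 1" for j
  proof -
    have "Poly_Mapping.keys (P j) \<subseteq> (\<Union>k\<le>degree (g j). {Poly_Mapping.single 0 k})"
      unfolding P_def by (rule order_trans[OF keys_sum]) (auto split: if_splits)
    then show ?thesis
      unfolding rpolys_def by (auto split: if_splits)
  qed
  moreover have "monom_eval (Poly_Mapping.single 0 k) x = x 0 ^ k" for k and x :: "nat \<Rightarrow> real"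
    by (cases "k = 0") (simp_all add: monom_eval_def)
  then have "rpoly_eval (P j) x = poly (g j) (x 0)" for j x
    by (simp add: P_def rpoly_eval_sum rpoly_eval_single poly_altdef)
  ultimately have "polynomial_map 1 (\<lambda>x. poly_curve g (x 0))"
    unfolding polynomial_map_def poly_curve_def by (metis vec_lambda_beta)
  moreover have "range (poly_curve g) = (\<lambda>x. poly_curve g (x 0)) ` topspace (Euclidean_space 1)"
  proof (intro equalityI subsetI; elim imageE; hypsubst)
    fix s
    have "(\<lambda>i::nat. if i = 0 then s else 0) \<in> topspace (Euclidean_space 1)"
      by (auto simp: topspace_Euclidean_space)
    then show "poly_curve g s \<in> (\<lambda>x. poly_curve g (x 0)) ` topspace (Euclidean_space 1)"
      by (rule rev_image_eqI) simp
  qed auto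
  ultimately show "polynomial_image 1 S"
    unfolding polynomial_image_def S by blast
qed

text \<open>A nonempty set of extended naturals contains its infimum, the empty one has infimum
  infinity, and \<open>1\<close> is the least admissible index.\<close>

lemma p_invariant_eq_1_iff: "p_invariant S = 1 \<longleftrightarrow> polynomial_image 1 S"
proof
  let ?A = "{enat p | p. p \<ge> 1 \<and> polynomial_image p S}"
  assume "p_invariant S = 1"
  then have Inf: "Inf ?A = 1" by (simp only: p_invariant_def)
  have "?A \<noteq> {}"
  proof
    assume "?A = {}"
    with Inf show False by (simp only: Inf_enat_def if_True) simp
  qed
  then have "Inf ?A \<in> ?A"
    unfolding Inf_enat_def by (metis (no_types, lifting) LeastI_ex ex_in_conv)
  then show "polynomial_image 1 S"
    unfolding Inf by (auto simp: one_enat_def)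
next
  assume "polynomial_image 1 S"
  then show "p_invariant S = 1"
    unfolding p_invariant_def
    by (intro antisym Inf_lower Inf_greatest) (auto simp: one_enat_def)
qed

section \<open>Properness of polynomial curves and closed images\<close>

lemma poly_tends_to_infinity:
  fixes p :: "real poly"
  assumes "degree p > 0"
  obtains r where "\<And>x. r \<le> \<bar>x\<bar> \<Longrightarrow> d \<le> \<bar>poly p x\<bar>"
proof -
  obtain a q where "p = pCons a q" by (cases p)
  with assms that show ?thesis
    using poly_infinity[of q d a] by (auto split: if_splits)
qed

text \<open>A nonconstant coordinate is unbounded at infinity, so the parameters of a convergent
  sequence stay in a compact interval, whose image is closed. A constant curve is a point.\<close>

lemma closed_range_poly_curve: "closed (range (poly_curve g))"
proof (cases "\<forall>j. degree (g j) = 0")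
  case True
  then have "range (poly_curve g) = {poly_curve g 0}"
    using poly_curve_constant[of g _ 0] by auto
  then show ?thesis by simp
next
  case False
  then obtain j where j: "degree (g j) > 0" by auto
  show ?thesis
    unfolding closed_sequential_limits
  proof safe
    fix x l assume x: "\<forall>n. x n \<in> range (poly_curve g)" and lim: "x \<longlonglongrightarrow> l"
    have "\<forall>n. \<exists>s. x n = poly_curve g s"
      using x by blast
    then obtain s where s: "\<And>n. x n = poly_curve g (s n)"
      by metis
    have "(\<lambda>n. x n $ j) \<longlonglongrightarrow> l $ j"
      using lim by (rule tendsto_vec_nth)
    then have "Bseq (\<lambda>n. x n $ j)"
      by (intro convergent_imp_Bseq convergentI)
    then obtain B where B: "\<And>n. \<bar>x n $ j\<bar> \<le> B"
      by (auto simp: Bseq_def)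
    obtain r where r: "\<And>x. r \<le> \<bar>x\<bar> \<Longrightarrow> B + 1 \<le> \<bar>poly (g j) x\<bar>"
      using poly_tends_to_infinity[OF j] by blast
    have "\<bar>s n\<bar> \<le> r" for n
    proof (rule ccontr)
      assume "\<not> ?thesis"
      then show False
        using r[of "s n"] B[of n] unfolding s poly_curve_def by simp
    qed
    then have "x n \<in> poly_curve g ` {-r..r}" for n
      unfolding s by (intro imageI) (auto simp: abs_le_iff minus_le_iff)
    moreover have "closed (poly_curve g ` {-r..r})"
      by (intro compact_imp_closed compact_continuous_image continuous_on_poly_curve) auto
    ultimately have "l \<in> poly_curve g ` {-r..r}"
      using lim closed_sequentially by metis
    then show "l \<in> range (poly_curve g)" by blast
  qed
qed

lemma closed_image_upper_half_line:
  assumes "is_interval T" "bdd_below T" "\<not> bdd_above T" "closed (poly_curve \<gamma> ` T)"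
  shows "\<exists>g. poly_curve \<gamma> ` T = range (poly_curve g)"
proof -
  let ?a = "Inf T"
  have "T \<noteq> {}" using assms(3) by auto
  have T_sub: "T \<subseteq> {?a..}"
    using assms(2) by (auto intro: cInf_lower)
  have sub_T: "{?a<..} \<subseteq> T"
  proof
    fix t assume "t \<in> {?a<..}"
    then obtain u where u: "u \<in> T" "u < t"
      using cInf_lessD[OF \<open>T \<noteq> {}\<close>, of t] by auto
    obtain w where w: "w \<in> T" "t \<le> w"
      using assms(3) by (meson bdd_aboveI nle_le)
    show "t \<in> T"
      using assms(1) u w unfolding is_interval_1 by (meson less_imp_le)
  qed
  \<comment> \<open>The endpoint may be missing from \<open>T\<close>, but its image is a limit of
    points of the closed image, so adding it changes nothing.\<close>
  have "?a \<in> closure T"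
    using \<open>T \<noteq> {}\<close> assms(2) by (rule closure_contains_Inf)
  then have "poly_curve \<gamma> ?a \<in> closure (poly_curve \<gamma> ` T)"
    using continuous_image_closure_subset[OF continuous_on_poly_curve, of T UNIV \<gamma>] by blast
  then have "poly_curve \<gamma> ?a \<in> poly_curve \<gamma> ` T"
    using assms(4) by simp
  moreover have "{?a..} = insert ?a {?a<..}" by auto
  ultimately have "poly_curve \<gamma> ` {?a..} \<subseteq> poly_curve \<gamma> ` T"
    using image_mono[OF sub_T, of "poly_curve \<gamma>"] by (simp only: image_insert insert_subset)
  then have "poly_curve \<gamma> ` {?a..} = poly_curve \<gamma> ` T"
    using image_mono[OF T_sub] by (rule antisym)
  moreover have "{?a..} = range (poly [:?a, 0, 1:])"
  proof (intro equalityI subsetI)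
    fix t assume "t \<in> {?a..}"
    then have "t = poly [:?a, 0, 1:] (sqrt (t - ?a))" by simp
    then show "t \<in> range (poly [:?a, 0, 1:])" by blast
  qed auto
  ultimately have "poly_curve \<gamma> ` T = range (poly_curve (\<lambda>j. \<gamma> j \<circ>\<^sub>p [:?a, 0, 1:]))"
    unfolding poly_curve_pcompose by (metis image_image)
  then show ?thesis by blast
qed

lemma closed_image_unbounded_interval:
  assumes T: "is_interval T" "\<not> bounded T" and closed: "closed (poly_curve \<gamma> ` T)"
  shows "\<exists>g. poly_curve \<gamma> ` T = range (poly_curve g)"
proof (cases "bdd_above T")
  case False
  show ?thesis
  proof (cases "bdd_below T")
    case True
    then show ?thesis
      using T(1) False closed by (intro closed_image_upper_half_line)
  next
    case below: False
    have "t \<in> T" for t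
    proof -
      obtain u where u: "u \<in> T" "u \<le> t"
        using below by (meson bdd_belowI nle_le)
      obtain w where w: "w \<in> T" "t \<le> w"
        using False by (meson bdd_aboveI nle_le)
      show ?thesis
        using T(1) u w unfolding is_interval_1 by blast
    qed
    then have "T = UNIV" by auto
    then show ?thesis by blast
  qed
next
  case True
  \<comment> \<open>Reversing the parameter reduces a half-line going down to one going up.\<close>
  define \<gamma>' where "\<gamma>' j = \<gamma> j \<circ>\<^sub>p [:0, -1:]" for j
  have image: "poly_curve \<gamma>' ` uminus ` T = poly_curve \<gamma> ` T"
    unfolding image_image \<gamma>'_def poly_curve_pcompose by simp
  have "\<not> bdd_below T"
  proof
    assume "bdd_below T"
    then obtain l u where "T \<subseteq> {l..u}"
      using True unfolding bdd_below_def bdd_above_def by (meson atLeastAtMost_iff subsetI)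
    then show False
      using T(2) bounded_closed_interval bounded_subset by metis
  qed
  then have "\<not> bdd_above (uminus ` T)" "bdd_below (uminus ` T)"
    using True by auto
  moreover have "is_interval (uminus ` T)"
    using T(1) by simp
  ultimately show ?thesis
    using closed_image_upper_half_line[of "uminus ` T" \<gamma>'] closed unfolding image by metis
qed

section \<open>Closed one-dimensional polynomial images\<close>

lemma closed_polynomial_image_dim_1:
  fixes S :: "(real ^ 'm) set"
  assumes dim: "semialgebraic_dim S = 1" and image: "polynomial_image n S" and closed: "closed S"
  shows "\<exists>g. S = range (poly_curve g)"
proof -
  let ?E = "topspace (Euclidean_space n)"
  obtain f where f: "polynomial_map n f" and S: "S = f ` ?E"
    using image unfolding polynomial_image_def by blast
  have E: "(\<lambda>i. p i + s * (q i - p i)) \<in> ?E" if "p \<in> ?E" "q \<in> ?E" for p q s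
    using that by (simp add: topspace_Euclidean_space)
  have curve_sub: "range (poly_curve g) \<subseteq> S"
    if "p \<in> ?E" "q \<in> ?E" "\<And>s. poly_curve g s = f (\<lambda>i. p i + s * (q i - p i))" for p q g
    unfolding S that(3) using E[OF that(1,2)] by blast
  have line: "\<exists>g. \<forall>s. poly_curve g s = f (\<lambda>i. p i + s * (q i - p i))"
    if pq: "p \<in> ?E" "q \<in> ?E" for p q
  proof -
    have v: "(\<lambda>i. q i - p i) \<in> ?E"
      using pq by (simp add: topspace_Euclidean_space)
    obtain g where "\<And>s. f (\<lambda>i. p i + s * (q i - p i)) = poly_curve g s"
      using polynomial_map_line[OF f pq(1) v] by blast
    then show ?thesis by metis
  qed
  have "S \<noteq> {}"
    unfolding S by (auto simp: topspace_Euclidean_space)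
  \<comment> \<open>The line through preimages of two points of \<open>S\<close> maps to a curve in
    \<open>S\<close> through both.\<close>
  have prime: "primeideal (vanishing_ideal S) (ring_of_type_algebra :: 'm rpoly ring)"
  proof (rule primeideal_vanishing_ideal[OF \<open>S \<noteq> {}\<close>])
    fix x y assume "x \<in> S" "y \<in> S"
    then obtain p q where p: "p \<in> ?E" "x = f p" and q: "q \<in> ?E" "y = f q"
      unfolding S by blast
    then obtain g where g: "\<And>s. poly_curve g s = f (\<lambda>i. p i + s * (q i - p i))"
      using line by blast
    have "poly_curve g 0 = x" "poly_curve g 1 = y"
      using p q by (auto simp: g)
    moreover have "range (poly_curve g) \<subseteq> S"
      using p(1) q(1) g by (rule curve_sub)
    ultimately show "\<exists>g. {x, y} \<subseteq> range (poly_curve g) \<and> range (poly_curve g) \<subseteq> S"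
      by blast
  qed
  have nonsingleton: "S \<noteq> {y}" for y
    using dim semialgebraic_dim_singleton[of y] by (metis zero_neq_one)
  obtain y where "y \<in> S"
    using \<open>S \<noteq> {}\<close> by blast
  moreover obtain z where "z \<in> S" "y \<noteq> z"
    using nonsingleton[of y] \<open>y \<in> S\<close> by blast
  ultimately obtain p q where p: "p \<in> ?E" and q: "q \<in> ?E" and ne: "f p \<noteq> f q"
    unfolding S by (elim imageE) simp
  obtain g where g: "\<And>s. poly_curve g s = f (\<lambda>i. p i + s * (q i - p i))"
    using line[OF p q] by blast
  have g_sub: "range (poly_curve g) \<subseteq> S"
    using p q g by (rule curve_sub)
  have "poly_curve g 0 \<noteq> poly_curve g 1"
    using ne by (simp add: g)
  then obtain i where i: "degree (g i) > 0"
    using poly_curve_constant[of g 0 1] by auto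
  obtain h \<gamma> a b where b: "rpoly_subst b g \<noteq> 0" and ba: "rpoly_subst b g * h = rpoly_subst a g"
    and \<gamma>: "\<And>j. g j = \<gamma> j \<circ>\<^sub>p h"
    by (rule polynomial_Lueroth[where g = g and i\<^sub>0 = i, OF i], rule that)
  \<comment> \<open>A base point where \<open>b\<close> is nonzero: there the parameter is
    determined by the image point, as \<open>a/b\<close>.\<close>
  obtain s\<^sub>0 where s\<^sub>0: "poly (rpoly_subst b g) s\<^sub>0 \<noteq> 0"
    using b poly_all_0_iff_0[of "rpoly_subst b g"] by blast
  define p\<^sub>0 where "p\<^sub>0 = (\<lambda>i. p i + s\<^sub>0 * (q i - p i))"
  define t\<^sub>0 where "t\<^sub>0 = poly h s\<^sub>0"
  have p\<^sub>0: "p\<^sub>0 \<in> ?E"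
    unfolding p\<^sub>0_def using E p q by blast
  have f_p\<^sub>0: "f p\<^sub>0 = poly_curve g s\<^sub>0"
    by (simp add: p\<^sub>0_def g)
  have f_t\<^sub>0: "f p\<^sub>0 = poly_curve \<gamma> t\<^sub>0"
    by (simp add: f_p\<^sub>0 t\<^sub>0_def poly_curve_def \<gamma> poly_pcompose)
  have b_p\<^sub>0: "rpoly_eval b (($) (f p\<^sub>0)) \<noteq> 0"
    using s\<^sub>0 by (simp add: f_p\<^sub>0 rpoly_eval_poly_curve)
  have ba_p\<^sub>0: "rpoly_eval b (($) (f p\<^sub>0)) * t\<^sub>0 = rpoly_eval a (($) (f p\<^sub>0))"
    using arg_cong[OF ba, of "\<lambda>p. poly p s\<^sub>0"] by (simp add: f_p\<^sub>0 rpoly_eval_poly_curve t\<^sub>0_def)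
  have "\<exists>h. poly h 0 = t\<^sub>0 \<and> f x \<in> poly_curve \<gamma> ` range (poly h) \<and> poly_curve \<gamma> ` range (poly h) \<subseteq> S"
    if x: "x \<in> ?E" for x
  proof -
    obtain g' where g': "\<And>s. poly_curve g' s = f (\<lambda>i. p\<^sub>0 i + s * (x i - p\<^sub>0 i))"
      using line[OF p\<^sub>0 x] by blast
    have g'_0: "poly_curve g' 0 = f p\<^sub>0" and g'_1: "poly_curve g' 1 = f x"
      by (simp_all add: g')
    have g'_sub: "range (poly_curve g') \<subseteq> S"
      using p\<^sub>0 x g' by (rule curve_sub)
    show ?thesis
    proof (cases "\<forall>j. degree (g' j) = 0")
      case True
      then have "f x = f p\<^sub>0"
        using poly_curve_constant[of g' 1 0] by (simp add: g'_0 g'_1)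
      moreover have "f p\<^sub>0 \<in> S"
        using p\<^sub>0 by (simp add: S)
      ultimately show ?thesis
        unfolding f_t\<^sub>0 by (intro exI[of _ "[:t\<^sub>0:]"]) auto
    next
      case False
      then obtain j where "degree (g' j) > 0" by auto
      then have "vanishing_ideal (range (poly_curve g')) = vanishing_ideal (range (poly_curve g))"
        using vanishing_ideal_curve_eq[OF dim prime g'_sub]
          vanishing_ideal_curve_eq[OF dim prime g_sub i] by simp
      then have same: "rpoly_subst P g = 0 \<longleftrightarrow> rpoly_subst P g' = 0" for P
        unfolding vanishing_ideal_poly_curve[symmetric] by simp
      obtain h' where h': "rpoly_subst b g' * h' = rpoly_subst a g'" "\<And>j. g' j = \<gamma> j \<circ>\<^sub>p h'"
        by (rule polynomial_parametrization_factors[where g = g and g' = g' and \<gamma> = \<gamma> and i\<^sub>0 = i,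
              OF b ba \<gamma> i same], rule that)
      \<comment> \<open>At \<open>s = 0\<close> the curve \<open>g'\<close> passes through
        \<open>f p\<^sub>0\<close>, where \<open>b\<close> is nonzero; so \<open>h'\<close> must
        start at the same parameter \<open>t\<^sub>0\<close>.\<close>
      have "rpoly_eval b (($) (f p\<^sub>0)) * poly h' 0 = rpoly_eval a (($) (f p\<^sub>0))"
        using arg_cong[OF h'(1), of "\<lambda>p. poly p 0"] by (simp flip: g'_0 add: rpoly_eval_poly_curve)
      then have "poly h' 0 = t\<^sub>0"
        using ba_p\<^sub>0 b_p\<^sub>0 by (metis mult_left_cancel)
      moreover have curve: "poly_curve g' s = poly_curve \<gamma> (poly h' s)" for s
        by (simp add: poly_curve_def h'(2) poly_pcompose)
      then have "f x \<in> poly_curve \<gamma> ` range (poly h')"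
        by (metis g'_1 imageI rangeI)
      moreover have "poly_curve \<gamma> ` range (poly h') \<subseteq> S"
        using g'_sub by (auto simp: curve)
      ultimately show ?thesis by blast
    qed
  qed
  then obtain H where H: "\<And>x. x \<in> ?E \<Longrightarrow> poly (H x) 0 = t\<^sub>0"
    "\<And>x. x \<in> ?E \<Longrightarrow> f x \<in> poly_curve \<gamma> ` range (poly (H x))"
    "\<And>x. x \<in> ?E \<Longrightarrow> poly_curve \<gamma> ` range (poly (H x)) \<subseteq> S"
    by metis
  define T where "T = (\<Union>x\<in>?E. range (poly (H x)))"
  have S_T: "S = poly_curve \<gamma> ` T"
  proof
    show "S \<subseteq> poly_curve \<gamma> ` T"
      using H(2) unfolding S T_def by blast
    show "poly_curve \<gamma> ` T \<subseteq> S"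
      using H(3) unfolding T_def by blast
  qed
  \<comment> \<open>All the intervals \<open>range (poly (H x))\<close> contain
    \<open>t\<^sub>0\<close>.\<close>
  have "connected T"
    unfolding T_def
  proof (rule connected_Union)
    show "connected U" if "U \<in> (\<lambda>x. range (poly (H x))) ` ?E" for U
      using that by (auto intro!: connected_continuous_image continuous_intros)
    have "t\<^sub>0 \<in> \<Inter> ((\<lambda>x. range (poly (H x))) ` ?E)"
      using H(1) by (metis (no_types, lifting) INT_I rangeI)
    then show "\<Inter> ((\<lambda>x. range (poly (H x))) ` ?E) \<noteq> {}" by blast
  qed
  then have "is_interval T"
    by (simp add: is_interval_connected_1)
  moreover have "\<not> bounded T"
  proof
    assume "bounded T"
    then obtain B where B: "\<And>t. t \<in> T \<Longrightarrow> \<bar>t\<bar> \<le> B"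
      by (auto simp: bounded_iff)
    \<comment> \<open>If \<open>T\<close> is bounded, every \<open>H x\<close> is constant with
      value \<open>t\<^sub>0\<close>, and \<open>S\<close> collapses to one point.\<close>
    have "degree (H x) = 0" if x: "x \<in> ?E" for x
    proof (rule ccontr)
      assume "degree (H x) \<noteq> 0"
      then obtain r where r: "\<And>s. r \<le> \<bar>s\<bar> \<Longrightarrow> B + 1 \<le> \<bar>poly (H x) s\<bar>"
        using poly_tends_to_infinity[of "H x" "B + 1"] by auto
      then have "B + 1 \<le> \<bar>poly (H x) \<bar>r\<bar>\<bar>"
        by simp
      moreover have "poly (H x) \<bar>r\<bar> \<in> T"
        using x by (auto simp: T_def)
      then have "\<bar>poly (H x) \<bar>r\<bar>\<bar> \<le> B"
        by (rule B)
      ultimately show False by linarith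
    qed
    then have "poly (H x) s = t\<^sub>0" if "x \<in> ?E" for x s
      using H(1) that by (metis degree_eq_zeroE poly_pCons poly_0 mult_zero_right)
    then have "T \<subseteq> {t\<^sub>0}" by (auto simp: T_def)
    then have "S \<subseteq> {poly_curve \<gamma> t\<^sub>0}"
      unfolding S_T by blast
    then show False
      using \<open>S \<noteq> {}\<close> nonsingleton by blast
  qed
  ultimately show ?thesis
    using closed closed_image_unbounded_interval unfolding S_T by blast
qed

theorem proposition1p2:
  fixes S :: "(real ^ 'm) set" and n :: nat
  assumes "semialgebraic S"
    and "semialgebraic_dim S = 1"
    and "n \<ge> 1"
    and "polynomial_image n S"
  shows "p_invariant S = 1 \<longleftrightarrow> closed S"
  using closed_polynomial_image_dim_1[OF assms(2,4)] closed_range_poly_curve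
  unfolding p_invariant_eq_1_iff polynomial_image_1_iff by blast

end
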